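(* Let $\mathbb U$ be an absolute universe and $G,H\in\mathbb U$. Suppose the Maintenance holds: - for every Right option $G^R$ of $G$ there is a Right option $H^R$ of $H$ with $G^R\succcurlyeq_{\mathbb U}H^R$, or a Left option $G^{RL}$ of $G^R$ with $G^{RL}\succcurlyeq_{\mathbb U}H$; and - for every Left option $H^L$ of $H$ there is a Left option $G^L$ of $G$ with $G^L\succcurlyeq_{\mathbb U}H^L$, or a Right option $H^{LR}$ of $H^L$ with $G\succcurlyeq_{\mathbb U}H^{LR}$. Then $G\succcurlyeq_{\mathbb U}H$ if $\mathbb U$ is 1. normal-play; 2. dicot misère-play, and $o(G)\ge o(H)$; 3. dead-ending misère-play, and $\underline{o}_L(G)\ge\underline{o}_L(H)$ and $\overline{o}_R(G)\ge\overline{o}_R(H)$; 4. free misère-play, and $H^{\mathcal L}=\emptyset^0\Rightarrow G^{\mathcal L}=\emptyset^0$, and $G^{\mathcal R}=\emptyset^0\Rightarrow H^{\mathcal R}=\emptyset^0$; 5. dicot scoring-play, and $o(G)\ge o(H)$; 6. guaranteed scoring-play, and $\underline{o}_L(G)\ge\underline{o}_L(H)$ and $\overline{o}_R(G)\ge\overline{o}_R(H)$; 7. free scoring-play, and $H^{\mathcal L}=\emptyset^a\Rightarrow G^{\mathcal L}=\emptyset^b$ with $b\ge a$, and $G^{\mathcal R}=\emptyset^a\Rightarrow H^{\mathcal R}=\emptyset^b$ with $a\ge b$.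
   Context: **Game forms.** Let $\mathcal A$ be a totally ordered additive abelian group. An atom $\emptyset^a$ ($a\in\mathcal A$) is an empty set of options adorned with $a$. Let $\Omega_0=\{\{\emptyset^\ell\mid\emptyset^r\}:\ell,r\in\mathcal A\}$, and for $n>0$ let $\Omega_n$ be the set of all forms $G=\{G^{\mathcal L}\mid G^{\mathcal R}\}$ in which each of $G^{\mathcal L}$ (set of Left options) and $G^{\mathcal R}$ (set of Right options) is either an atom or a non-empty finite set of elements of $\Omega_{n-1}$. Put $\Omega=\bigcup_n\Omega_n$ (the free space $(\Omega,\mathcal A)$). A form is Left-atomic (Right-atomic) if $G^{\mathcal L}$ ($G^{\mathcal R}$) is an atom. The followers of $G$ are $G$ itself and all positions reachable from it by any sequence of (not necessarily alternating) moves. Write $\boldsymbol 0=\{\emptyset^0\mid\emptyset^0\}$. **Disjunctive sum.** $G+H$ is defined recursively: if $G^{\mathcal L}=\emptyset^{\ell_1}$ and $H^{\mathcal L}=\emptyset^{\ell_2}$, then the Left side of $G+H$ is $\emptyset^{\ell_1+\ell_2}$; otherwise its Left options are all $G^L+H$ and all $G+H^L$. The Right side is defined analogously. **Conjugate.** The conjugate of $G$ is obtained recursively by swapping the Left and Right sides, conjugating all options, and negating adorns. **Universe.** A universe is a subset $\mathbb U\subseteq\Omega$ such that $\{\emptyset^a\mid\emptyset^a\}\in\mathbb U$ for all $a\in\mathcal A$, and $\mathbb U$ is closed under taking options, disjunctive sums and conjugates. **Outcomes.** Given a totally ordered set $\mathcal S$ and order preserving maps $\nu_L,\nu_R:\mathcal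 A\to\mathcal S$: $o_L(G)=\nu_L(\ell)$ if $G^{\mathcal L}=\emptyset^\ell$, otherwise $o_L(G)=\max_{G^L} o_R(G^L)$; $o_R(G)=\nu_R(r)$ if $G^{\mathcal R}=\emptyset^r$, otherwise $o_R(G)=\min_{G^R}o_L(G^R)$. Put $o(G)=(o_L(G),o_R(G))$; $o(G)\ge o(H)$ means $o_L(G)\ge o_L(H)$ and $o_R(G)\ge o_R(H)$. **Absolute.** $\mathbb U$ is parental if $\{\mathcal G\mid\mathcal H\}\in\mathbb U$ for all finite non-empty $\mathcal G,\mathcal H\subset\mathbb U$; saturated if for all $G\in\mathbb U$, $x,y\in\mathcal S$ there is $H\in\mathbb U$ with $o_L(G+H)\ge x$ and $o_R(G+H)\le y$; absolute if both. **Order.** $G\succcurlyeq_{\mathbb U}H$ means $o_L(G+X)\ge o_L(H+X)$ and $o_R(G+X)\ge o_R(H+X)$ for all $X\in\mathbb U$. **The specific universes.** - Normal-play: $\mathcal A=\{0\}$, $\mathcal S=\{-1,+1\}$, $\nu_L(0)=-1$, $\nu_R(0)=+1$; the universe is all of $\Omega$. - Misère-play: $\mathcal A=\{0\}$, $\mathcal S=\{-1,+1\}$, $\nu_L(0)=+1$, $\nu_R(0)=-1$. Free misère-play is all of $\Omega$. Dicot misère-play: all forms such that every follower is Left-atomic if and only if it is Right-atomic. Dead-ending misère-play: all forms such that, whenever a follower $K$ is Left-atomic (Right-atomic), every follower of $K$ is Left-atomic (Right-atomic). - Scoring-play: $\mathcal A=\mathcal S=\mathbb R$ with $\nu_L=\nu_R$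 the identity. Free scoring-play is all of $\Omega$. Dicot scoring-play: all forms such that every follower either has both a Left and a Right option or equals $\{\emptyset^a\mid\emptyset^a\}$ for some $a\in\mathbb R$. Guaranteed scoring-play: all forms such that for every Left-atomic follower $K$ with $K^{\mathcal L}=\emptyset^\ell$, every adorn occurring (on either side) in an atomic follower of $K$ is $\ge\ell$, and for every Right-atomic follower $K$ with $K^{\mathcal R}=\emptyset^r$, every adorn occurring in an atomic follower of $K$ is $\le r$. **Waiting-protected outcomes.** $\underline{o}_L(G)=\min\{o_L(G+\underline n):n\ge 0\}$ and $\overline{o}_R(G)=\max\{o_R(G+\overline n):n\ge0\}$, where $\underline 0=\overline 0=\boldsymbol 0$ and, for $n\ge1$: in dead-ending misère-play, $\underline n=\{\emptyset^0\mid\boldsymbol 0,\underline{n-1}\}$ and $\overline n=\{\boldsymbol 0,\overline{n-1}\mid\emptyset^0\}$; in guaranteed scoring-play, $\underline n=\{\emptyset^0\mid\underline{n-1}\}$ and $\overline n=\{\overline{n-1}\mid\emptyset^0\}$. *)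

theory Defs
  imports Complex_Main "HOL-Library.FSet"
begin

section \<open>Game forms\<close>

text \<open>A side of a form is an atom adorned with a group element, or a finite set of options.
  The type admits \<open>Options {||}\<close>; the free space \<open>Omega\<close> below excludes it hereditarily.\<close>

datatype ('a, 'g) side = Atom 'a | Options "'g fset"

datatype 'a form = Form (lside: "('a, 'a form) side") (rside: "('a, 'a form) side")

fun opts :: "('a, 'g) side \<Rightarrow> 'g fset" where
  "opts (Atom a) = {||}"
| "opts (Options X) = X"

fun is_atom :: "('a, 'g) side \<Rightarrow> bool" where
  "is_atom (Atom a) = True"
| "is_atom (Options X) = False"

definition lopts :: "'a form \<Rightarrow> 'a form fset" where
  "lopts G = opts (lside G)"

definition ropts :: "'a form \<Rightarrow> 'a form fset" where
  "ropts G = opts (rside G)"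

definition left_atomic :: "'a form \<Rightarrow> bool" where
  "left_atomic G \<longleftrightarrow> is_atom (lside G)"

definition right_atomic :: "'a form \<Rightarrow> bool" where
  "right_atomic G \<longleftrightarrow> is_atom (rside G)"

definition const_form :: "'a \<Rightarrow> 'a form" where
  "const_form a = Form (Atom a) (Atom a)"

text \<open>The group of adorns is given by a carrier set \<open>A\<close>, so that the trivial group \<open>{0}\<close>
  can be used as well as all of \<open>\<real>\<close>.\<close>

definition sides :: "'a set \<Rightarrow> 'a form set \<Rightarrow> ('a, 'a form) side set" where
  "sides A W = {Atom a |a. a \<in> A} \<union> {Options X |X. X \<noteq> {||} \<and> fset X \<subseteq> W}"

primrec Omega_n :: "'a set \<Rightarrow> nat \<Rightarrow> 'a form set" where
  "Omega_n A 0 = {Form (Atom l) (Atom r) |l r. l \<in> A \<and> r \<in> A}"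
| "Omega_n A (Suc n) =
     {Form L R |L R. L \<in> sides A (Omega_n A n) \<and> R \<in> sides A (Omega_n A n)}"

definition Omega :: "'a set \<Rightarrow> 'a form set" where
  "Omega A = (\<Union>n. Omega_n A n)"

inductive_set followers :: "'a form \<Rightarrow> 'a form set" for G where
  self: "G \<in> followers G"
| left: "K \<in> followers G \<Longrightarrow> K' |\<in>| lopts K \<Longrightarrow> K' \<in> followers G"
| right: "K \<in> followers G \<Longrightarrow> K' |\<in>| ropts K \<Longrightarrow> K' \<in> followers G"

lemma size_lopts: "x |\<in>| lopts G \<Longrightarrow> size x < size G"
  and size_ropts: "x |\<in>| ropts G \<Longrightarrow> size x < size G"
proof -
  have *: "size x < Suc (\<Sum>p\<in>(\<lambda>g. (g, size g)) ` fset X. Suc (snd p))"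
    if "x |\<in>| X" for x :: "'a form" and X
    using member_le_sum[of "(x, size x)" "(\<lambda>g. (g, size g)) ` fset X" "\<lambda>p. Suc (snd p)"] that
    by auto
  show "x |\<in>| lopts G \<Longrightarrow> size x < size G"
    by (cases G; cases "lside G") (auto simp: lopts_def dest!: *)
  show "x |\<in>| ropts G \<Longrightarrow> size x < size G"
    by (cases G; cases "rside G") (auto simp: ropts_def dest!: *)
qed

section \<open>Disjunctive sum and conjugate\<close>

function gsum :: "'a::plus form \<Rightarrow> 'a form \<Rightarrow> 'a form" (infixl "\<oplus>" 65) where
  "G \<oplus> H =
     Form
       (case (lside G, lside H) of
          (Atom a, Atom b) \<Rightarrow> Atom (a + b)
        | _ \<Rightarrow> Options ((\<lambda>K. K \<oplus> H) |`| lopts G |\<union>| (\<lambda>K. G \<oplus> K) |`| lopts H))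
       (case (rside G, rside H) of
          (Atom a, Atom b) \<Rightarrow> Atom (a + b)
        | _ \<Rightarrow> Options ((\<lambda>K. K \<oplus> H) |`| ropts G |\<union>| (\<lambda>K. G \<oplus> K) |`| ropts H))"
  by pat_completeness auto
termination
  by (relation "measure (\<lambda>(G, H). size G + size H)") (auto dest: size_lopts size_ropts)

declare gsum.simps [simp del]

primrec conjugate_form :: "'a::uminus form \<Rightarrow> 'a form" where
  "conjugate_form (Form L R) =
     Form (map_side uminus conjugate_form R) (map_side uminus conjugate_form L)"

section \<open>Outcomes\<close>

function oL :: "('a \<Rightarrow> 's::linorder) \<Rightarrow> ('a \<Rightarrow> 's) \<Rightarrow> 'a form \<Rightarrow> 's"
  and oR :: "('a \<Rightarrow> 's::linorder) \<Rightarrow> ('a \<Rightarrow> 's) \<Rightarrow> 'a form \<Rightarrow> 's" where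
  "oL nuL nuR G =
     (case lside G of Atom l \<Rightarrow> nuL l | Options X \<Rightarrow> Max (oR nuL nuR ` fset (lopts G)))"
| "oR nuL nuR G =
     (case rside G of Atom r \<Rightarrow> nuR r | Options X \<Rightarrow> Min (oL nuL nuR ` fset (ropts G)))"
  by pat_completeness auto
termination
  by (relation "measure (case_sum (\<lambda>(_, _, G). size G) (\<lambda>(_, _, G). size G))")
     (auto dest: size_lopts size_ropts)

declare oL.simps [simp del] oR.simps [simp del]

definition outcome_ge :: "('a \<Rightarrow> 's::linorder) \<Rightarrow> ('a \<Rightarrow> 's) \<Rightarrow> 'a form \<Rightarrow> 'a form \<Rightarrow> bool" where
  "outcome_ge nuL nuR G H \<longleftrightarrow>
     oL nuL nuR G \<ge> oL nuL nuR H \<and> oR nuL nuR G \<ge> oR nuL nuR H"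

definition game_ge ::
  "('a::plus \<Rightarrow> 's::linorder) \<Rightarrow> ('a \<Rightarrow> 's) \<Rightarrow> 'a form set \<Rightarrow> 'a form \<Rightarrow> 'a form \<Rightarrow> bool" where
  "game_ge nuL nuR U G H \<longleftrightarrow> (\<forall>X\<in>U. outcome_ge nuL nuR (G \<oplus> X) (H \<oplus> X))"

section \<open>Absolute universes\<close>

definition universe :: "'a::linordered_ab_group_add set \<Rightarrow> 'a form set \<Rightarrow> bool" where
  "universe A U \<longleftrightarrow>
     U \<subseteq> Omega A \<and>
     (\<forall>a\<in>A. const_form a \<in> U) \<and>
     (\<forall>G\<in>U. fset (lopts G) \<subseteq> U \<and> fset (ropts G) \<subseteq> U) \<and>
     (\<forall>G\<in>U. \<forall>H\<in>U. G \<oplus> H \<in> U) \<and>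
     (\<forall>G\<in>U. conjugate_form G \<in> U)"

definition parental :: "'a form set \<Rightarrow> bool" where
  "parental U \<longleftrightarrow>
     (\<forall>X Y. X \<noteq> {||} \<and> Y \<noteq> {||} \<and> fset X \<subseteq> U \<and> fset Y \<subseteq> U \<longrightarrow>
        Form (Options X) (Options Y) \<in> U)"

definition saturated ::
  "'s::linorder set \<Rightarrow> ('a::plus \<Rightarrow> 's) \<Rightarrow> ('a \<Rightarrow> 's) \<Rightarrow> 'a form set \<Rightarrow> bool" where
  "saturated S nuL nuR U \<longleftrightarrow>
     (\<forall>G\<in>U. \<forall>x\<in>S. \<forall>y\<in>S. \<exists>H\<in>U. oL nuL nuR (G \<oplus> H) \<ge> x \<and> oR nuL nuR (G \<oplus> H) \<le> y)"

definition absolute_universe ::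
  "'a::linordered_ab_group_add set \<Rightarrow> 's::linorder set \<Rightarrow> ('a \<Rightarrow> 's) \<Rightarrow> ('a \<Rightarrow> 's) \<Rightarrow>
   'a form set \<Rightarrow> bool" where
  "absolute_universe A S nuL nuR U \<longleftrightarrow>
     universe A U \<and> parental U \<and> saturated S nuL nuR U"

definition maintenance ::
  "('a::plus \<Rightarrow> 's::linorder) \<Rightarrow> ('a \<Rightarrow> 's) \<Rightarrow> 'a form set \<Rightarrow> 'a form \<Rightarrow> 'a form \<Rightarrow> bool" where
  "maintenance nuL nuR U G H \<longleftrightarrow>
     (\<forall>GR. GR |\<in>| ropts G \<longrightarrow>
        (\<exists>HR. HR |\<in>| ropts H \<and> game_ge nuL nuR U GR HR) \<or>
        (\<exists>GRL. GRL |\<in>| lopts GR \<and> game_ge nuL nuR U GRL H)) \<and>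
     (\<forall>HL. HL |\<in>| lopts H \<longrightarrow>
        (\<exists>GL. GL |\<in>| lopts G \<and> game_ge nuL nuR U GL HL) \<or>
        (\<exists>HLR. HLR |\<in>| ropts HL \<and> game_ge nuL nuR U G HLR))"

section \<open>Specific universes\<close>

text \<open>Normal-play and misere-play use the carrier \<open>{0}\<close>, on which the following
  constant maps are evaluated.\<close>

definition normal_nuL :: "int \<Rightarrow> int" where "normal_nuL _ = -1"
definition normal_nuR :: "int \<Rightarrow> int" where "normal_nuR _ = 1"
definition misere_nuL :: "int \<Rightarrow> int" where "misere_nuL _ = 1"
definition misere_nuR :: "int \<Rightarrow> int" where "misere_nuR _ = -1"
definition scoring_nu :: "real \<Rightarrow> real" where "scoring_nu x = x"

definition normal_play :: "int form set" where
  "normal_play = Omega {0}"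

definition free_misere :: "int form set" where
  "free_misere = Omega {0}"

definition dicot_misere :: "int form set" where
  "dicot_misere =
     {G \<in> Omega {0}. \<forall>K\<in>followers G. left_atomic K \<longleftrightarrow> right_atomic K}"

definition dead_ending_misere :: "int form set" where
  "dead_ending_misere =
     {G \<in> Omega {0}. \<forall>K\<in>followers G.
        (left_atomic K \<longrightarrow> (\<forall>F\<in>followers K. left_atomic F)) \<and>
        (right_atomic K \<longrightarrow> (\<forall>F\<in>followers K. right_atomic F))}"

definition free_scoring :: "real form set" where
  "free_scoring = Omega UNIV"

definition dicot_scoring :: "real form set" where
  "dicot_scoring =
     {G \<in> Omega UNIV. \<forall>K\<in>followers G.
        (lopts K \<noteq> {||} \<and> ropts K \<noteq> {||}) \<or> (\<exists>a. K = const_form a)}"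

definition guaranteed_scoring :: "real form set" where
  "guaranteed_scoring =
     {G \<in> Omega UNIV. \<forall>K\<in>followers G.
        (\<forall>l. lside K = Atom l \<longrightarrow>
           (\<forall>F\<in>followers K. \<forall>a. lside F = Atom a \<or> rside F = Atom a \<longrightarrow> a \<ge> l)) \<and>
        (\<forall>r. rside K = Atom r \<longrightarrow>
           (\<forall>F\<in>followers K. \<forall>a. lside F = Atom a \<or> rside F = Atom a \<longrightarrow> a \<le> r))}"

section \<open>Waiting-protected outcomes\<close>

primrec dead_lower_wait :: "nat \<Rightarrow> int form" where
  "dead_lower_wait 0 = const_form 0"
| "dead_lower_wait (Suc n) = Form (Atom 0) (Options {|const_form 0, dead_lower_wait n|})"

primrec dead_upper_wait :: "nat \<Rightarrow> int form" where
  "dead_upper_wait 0 = const_form 0"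
| "dead_upper_wait (Suc n) = Form (Options {|const_form 0, dead_upper_wait n|}) (Atom 0)"

primrec score_lower_wait :: "nat \<Rightarrow> real form" where
  "score_lower_wait 0 = const_form 0"
| "score_lower_wait (Suc n) = Form (Atom 0) (Options {|score_lower_wait n|})"

primrec score_upper_wait :: "nat \<Rightarrow> real form" where
  "score_upper_wait 0 = const_form 0"
| "score_upper_wait (Suc n) = Form (Options {|score_upper_wait n|}) (Atom 0)"

text \<open>The ranges below are finite whenever \<open>G\<close> lies in the free space: every adorn of a
  waiting game is \<open>0\<close>, so all the outcomes are values of \<open>nuL\<close> or \<open>nuR\<close> at the finitely many
  adorns of followers of \<open>G\<close>. Hence \<open>Min\<close> and \<open>Max\<close> are genuine.\<close>

definition protected_oL ::
  "('a::plus \<Rightarrow> 's::linorder) \<Rightarrow> ('a \<Rightarrow> 's) \<Rightarrow> (nat \<Rightarrow> 'a form) \<Rightarrow> 'a form \<Rightarrow> 's" where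
  "protected_oL nuL nuR w G = Min (range (\<lambda>n. oL nuL nuR (G \<oplus> w n)))"

definition protected_oR ::
  "('a::plus \<Rightarrow> 's::linorder) \<Rightarrow> ('a \<Rightarrow> 's) \<Rightarrow> (nat \<Rightarrow> 'a form) \<Rightarrow> 'a form \<Rightarrow> 's" where
  "protected_oR nuL nuR w G = Max (range (\<lambda>n. oR nuL nuR (G \<oplus> w n)))"

end

theory Submission
  imports Defs
begin

text \<open>Compare \<open>G + X\<close> with \<open>H + X\<close> by induction on \<open>X\<close>. The Maintenance answers every move in
  \<open>H\<close> or \<open>G\<close>, and a move in \<open>X\<close> is copied, so \<open>o\<^sub>L(G + X) \<ge> o\<^sub>L(H + X)\<close> can only fail when
  Left has no move in \<open>H + X\<close>, that is, when \<open>H\<close> and \<open>X\<close> are both Left-atomic. In each universe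
  the extra hypothesis covers this case: in the dicot universes \<open>X\<close> is a constant, and in the
  dead-ending and guaranteed universes a Left-atomic \<open>X\<close> is no worse for Left than a waiting
  game that gives Right sufficiently many moves. Right's case follows by conjugation.\<close>

section \<open>Followers and adorns\<close>

lemma Omega_option:
  assumes "G \<in> Omega A" "K |\<in>| lopts G \<or> K |\<in>| ropts G"
  shows "K \<in> Omega A"
proof -
  obtain n where "G \<in> Omega_n A n"
    using assms(1) by (auto simp: Omega_def)
  then show ?thesis
    using assms(2) by (cases n) (auto simp: lopts_def ropts_def sides_def Omega_def)
qed

lemma Omega_lopts: "G \<in> Omega A \<Longrightarrow> K |\<in>| lopts G \<Longrightarrow> K \<in> Omega A"
  and Omega_ropts: "G \<in> Omega A \<Longrightarrow> K |\<in>| ropts G \<Longrightarrow> K \<in> Omega A"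
  by (blast intro: Omega_option)+

lemma Omega_lside_cases:
  assumes "G \<in> Omega A"
  obtains (Atom) a where "a \<in> A" "lside G = Atom a" | (Option) K where "K |\<in>| lopts G"
proof -
  obtain n where "G \<in> Omega_n A n"
    using assms by (auto simp: Omega_def)
  then have "(\<exists>a\<in>A. lside G = Atom a) \<or> (\<exists>K. K |\<in>| lopts G)"
    by (cases n) (auto simp: lopts_def sides_def)
  then show thesis
    using that by blast
qed

lemma Omega_rside_cases:
  assumes "G \<in> Omega A"
  obtains (Atom) a where "a \<in> A" "rside G = Atom a" | (Option) K where "K |\<in>| ropts G"
proof -
  obtain n where "G \<in> Omega_n A n"
    using assms by (auto simp: Omega_def)
  then have "(\<exists>a\<in>A. rside G = Atom a) \<or> (\<exists>K. K |\<in>| ropts G)"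
    by (cases n) (auto simp: ropts_def sides_def)
  then show thesis
    using that by blast
qed

lemma left_atomic_iff: "left_atomic G \<longleftrightarrow> (\<exists>a. lside G = Atom a)"
  by (cases "lside G") (auto simp: left_atomic_def)

lemma right_atomic_iff: "right_atomic G \<longleftrightarrow> (\<exists>a. rside G = Atom a)"
  by (cases "rside G") (auto simp: right_atomic_def)

lemma lopts_Atom: "lside G = Atom a \<Longrightarrow> lopts G = {||}"
  and ropts_Atom: "rside G = Atom a \<Longrightarrow> ropts G = {||}"
  by (auto simp: lopts_def ropts_def)

lemma Omega_lside_Atom: "G \<in> Omega A \<Longrightarrow> lside G = Atom a \<Longrightarrow> a \<in> A"
  by (erule Omega_lside_cases) (auto simp: lopts_Atom)

lemma Omega_rside_Atom: "G \<in> Omega A \<Longrightarrow> rside G = Atom a \<Longrightarrow> a \<in> A"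
  by (erule Omega_rside_cases) (auto simp: ropts_Atom)

text \<open>Level 0 has only atomic sides, which every level admits, and \<open>sides\<close> is
  monotone in its second argument, so each level includes the previous one.\<close>

lemma Omega_n_mono: "m \<le> n \<Longrightarrow> Omega_n A m \<subseteq> Omega_n A n"
proof (rule lift_Suc_mono_le)
  show "Omega_n A n \<subseteq> Omega_n A (Suc n)" for n
  proof (induction n)
    case (Suc n)
    then have "sides A (Omega_n A n) \<subseteq> sides A (Omega_n A (Suc n))"
      unfolding sides_def by blast
    then show ?case
      unfolding Omega_n.simps(2)[of A "Suc n"] by (subst Omega_n.simps(2)) blast
  qed (auto simp: sides_def)
qed

text \<open>Options may lie in different levels, but there are finitely many of them, so one level
  contains them all and the form lies one level higher.\<close>

lemma Omega_I:
  assumes L: "(\<exists>a\<in>A. lside G = Atom a) \<or> lopts G \<noteq> {||}"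
    and R: "(\<exists>a\<in>A. rside G = Atom a) \<or> ropts G \<noteq> {||}"
    and opt: "\<And>K. K |\<in>| lopts G |\<union>| ropts G \<Longrightarrow> K \<in> Omega A"
  shows "G \<in> Omega A"
proof -
  let ?O = "fset (lopts G |\<union>| ropts G)"
  have "\<forall>K\<in>?O. \<exists>n. K \<in> Omega_n A n"
    using opt by (auto simp: Omega_def)
  then obtain f where f: "\<And>K. K \<in> ?O \<Longrightarrow> K \<in> Omega_n A (f K)"
    by metis
  \<comment> \<open>The sum of the chosen levels serves as a common upper bound, since each summand
    is a natural number below it.\<close>
  have "K \<in> Omega_n A (\<Sum>K\<in>?O. f K)" if "K \<in> ?O" for K
    using f[OF that] Omega_n_mono[OF member_le_sum[OF that, of f]] by auto
  then have "fset (lopts G) \<subseteq> Omega_n A (sum f ?O)" "fset (ropts G) \<subseteq> Omega_n A (sum f ?O)"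
    by auto
  moreover have "s \<in> sides A W"
    if "(\<exists>a\<in>A. s = Atom a) \<or> opts s \<noteq> {||}" "fset (opts s) \<subseteq> W" for s W
    using that by (cases s) (auto simp: sides_def)
  ultimately have "lside G \<in> sides A (Omega_n A (sum f ?O))" "rside G \<in> sides A (Omega_n A (sum f ?O))"
    using L R unfolding lopts_def ropts_def by blast+
  then have "Form (lside G) (rside G) \<in> Omega_n A (Suc (sum f ?O))"
    unfolding Omega_n.simps by blast
  then show ?thesis
    unfolding Omega_def form.collapse by blast
qed

section \<open>Followers\<close>

lemma followers_trans:
  assumes "F \<in> followers K" "K \<in> followers G"
  shows "F \<in> followers G"
  using assms by (induction rule: followers.induct) (auto intro: followers.intros)

lemma followers_option:
  assumes "F \<in> followers K" "K |\<in>| lopts G \<or> K |\<in>| ropts G"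
  shows "F \<in> followers G"
  using assms(2) followers_trans[OF assms(1)] followers.intros by blast

text \<open>The inductive definition extends a line of play at its end. Splitting off the first move
  instead gives a recursion that fits inductions on the size of \<open>G\<close>.\<close>

lemma followers_unfold:
  "followers G = insert G (\<Union>K\<in>fset (lopts G) \<union> fset (ropts G). followers K)"
proof
  show "followers G \<subseteq> insert G (\<Union>K\<in>fset (lopts G) \<union> fset (ropts G). followers K)"
  proof
    fix F assume "F \<in> followers G"
    then show "F \<in> insert G (\<Union>K\<in>fset (lopts G) \<union> fset (ropts G). followers K)"
      by (induction rule: followers.induct) (auto intro: followers.intros)
  qed
qed (auto intro: followers.self followers_option)

lemma finite_followers: "finite (followers G)"
proof (induction G rule: measure_induct_rule[of size])
  case (less G)
  then show ?case
    by (subst followers_unfold) (auto dest: size_lopts size_ropts)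
qed

section \<open>Adorns, the values with which a play can end\<close>

definition adorns :: "'a form \<Rightarrow> 'a set" where
  "adorns G = {a. \<exists>F\<in>followers G. lside F = Atom a \<or> rside F = Atom a}"

lemma adorns_lside: "lside G = Atom a \<Longrightarrow> a \<in> adorns G"
  and adorns_rside: "rside G = Atom a \<Longrightarrow> a \<in> adorns G"
  by (auto simp: adorns_def intro: followers.self)

lemma adorns_option:
  assumes "a \<in> adorns K" "K |\<in>| lopts G \<or> K |\<in>| ropts G"
  shows "a \<in> adorns G"
  using assms(1) followers_option[OF _ assms(2)] unfolding adorns_def by blast

lemma adorns_unfold:
  "adorns G = {a. lside G = Atom a \<or> rside G = Atom a} \<union>
     (\<Union>K\<in>fset (lopts G) \<union> fset (ropts G). adorns K)"
  unfolding adorns_def by (subst followers_unfold) blast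

lemma finite_adorns: "finite (adorns G)"
proof -
  have "adorns G \<subseteq> (\<Union>F\<in>followers G.
      {a. lside F = Atom a} \<union> {a. rside F = Atom a})"
    by (auto simp: adorns_def)
  moreover have "finite {a. s = Atom a}" for s :: "('a, 'a form) side"
    by (cases s) auto
  ultimately show ?thesis
    by (elim finite_subset) (simp add: finite_followers)
qed

section \<open>Outcomes of disjunctive sums\<close>

text \<open>No case distinction arises: if both sides are atoms, both images are empty, and so are
  the options of the resulting atom.\<close>

lemma lopts_gsum:
  "lopts (G \<oplus> H) = (\<lambda>K. K \<oplus> H) |`| lopts G |\<union>| (\<lambda>K. G \<oplus> K) |`| lopts H"
  by (subst gsum.simps) (auto simp: lopts_def split: side.splits)

lemma ropts_gsum:
  "ropts (G \<oplus> H) = (\<lambda>K. K \<oplus> H) |`| ropts G |\<union>| (\<lambda>K. G \<oplus> K) |`| ropts H"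
  by (subst gsum.simps) (auto simp: ropts_def split: side.splits)

lemma lside_gsum: "lside G = Atom a \<Longrightarrow> lside H = Atom b \<Longrightarrow> lside (G \<oplus> H) = Atom (a + b)"
  and rside_gsum: "rside G = Atom a \<Longrightarrow> rside H = Atom b \<Longrightarrow> rside (G \<oplus> H) = Atom (a + b)"
  by (subst gsum.simps; simp)+

lemma gsum_Omega:
  assumes "\<And>a b. a \<in> A \<Longrightarrow> b \<in> A \<Longrightarrow> a + b \<in> A" "G \<in> Omega A" "H \<in> Omega A"
  shows "G \<oplus> H \<in> Omega A"
  using assms(2,3)
proof (induction "size G + size H" arbitrary: G H rule: less_induct)
  case less
  have G: "K \<oplus> H \<in> Omega A" if "K |\<in>| lopts G \<or> K |\<in>| ropts G" for K
    using that less.prems Omega_option[of G]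
    by (intro less.hyps) (auto dest: size_lopts size_ropts)
  have H: "G \<oplus> K \<in> Omega A" if "K |\<in>| lopts H \<or> K |\<in>| ropts H" for K
    using that less.prems Omega_option[of H]
    by (intro less.hyps) (auto dest: size_lopts size_ropts)
  show ?case
  proof (rule Omega_I)
    show "(\<exists>a\<in>A. lside (G \<oplus> H) = Atom a) \<or> lopts (G \<oplus> H) \<noteq> {||}"
      using less.prems(1)
    proof (cases rule: Omega_lside_cases)
      case (Atom a)
      show ?thesis
        using less.prems(2) by (cases rule: Omega_lside_cases)
          (use Atom assms(1) lside_gsum[OF Atom(2)] in \<open>fastforce simp: lopts_gsum\<close>)+
    qed (auto simp: lopts_gsum)
    show "(\<exists>a\<in>A. rside (G \<oplus> H) = Atom a) \<or> ropts (G \<oplus> H) \<noteq> {||}"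
      using less.prems(1)
    proof (cases rule: Omega_rside_cases)
      case (Atom a)
      show ?thesis
        using less.prems(2) by (cases rule: Omega_rside_cases)
          (use Atom assms(1) rside_gsum[OF Atom(2)] in \<open>fastforce simp: ropts_gsum\<close>)+
    qed (auto simp: ropts_gsum)
  qed (use G H in \<open>auto simp: lopts_gsum ropts_gsum\<close>)
qed

section \<open>Outcomes as values attained by a best move\<close>

lemma oL_Atom: "lside G = Atom a \<Longrightarrow> oL nuL nuR G = nuL a"
  by (simp add: oL.simps)

lemma oR_Atom: "rside G = Atom a \<Longrightarrow> oR nuL nuR G = nuR a"
  by (simp add: oR.simps)

lemma oL_Options: "K |\<in>| lopts G \<Longrightarrow> oL nuL nuR G = Max (oR nuL nuR ` fset (lopts G))"
  by (cases "lside G") (auto simp: oL.simps[of _ _ G] lopts_def)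

lemma oR_Options: "K |\<in>| ropts G \<Longrightarrow> oR nuL nuR G = Min (oL nuL nuR ` fset (ropts G))"
  by (cases "rside G") (auto simp: oR.simps[of _ _ G] ropts_def)

lemma oR_le_oL: "K |\<in>| lopts G \<Longrightarrow> oR nuL nuR K \<le> oL nuL nuR G"
  by (auto simp: oL_Options)

lemma oR_le_oL': "K |\<in>| ropts G \<Longrightarrow> oR nuL nuR G \<le> oL nuL nuR K"
  by (auto simp: oR_Options)

lemma oL_attained:
  assumes "K |\<in>| lopts G"
  obtains L where "L |\<in>| lopts G" "oL nuL nuR G = oR nuL nuR L"
proof -
  have "oL nuL nuR G \<in> oR nuL nuR ` fset (lopts G)"
    unfolding oL_Options[OF assms] using assms by (intro Max_in) auto
  then show thesis
    using that by auto
qed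

lemma oR_attained:
  assumes "K |\<in>| ropts G"
  obtains R where "R |\<in>| ropts G" "oR nuL nuR G = oL nuL nuR R"
proof -
  have "oR nuL nuR G \<in> oL nuL nuR ` fset (ropts G)"
    unfolding oR_Options[OF assms] using assms by (intro Min_in) auto
  then show thesis
    using that by auto
qed

lemma oL_gsum_ge:
  "L |\<in>| lopts G \<Longrightarrow> oR nuL nuR (L \<oplus> X) \<le> oL nuL nuR (G \<oplus> X)"
  "L |\<in>| lopts X \<Longrightarrow> oR nuL nuR (G \<oplus> L) \<le> oL nuL nuR (G \<oplus> X)"
  by (auto intro!: oR_le_oL simp: lopts_gsum)

lemma oR_gsum_le:
  "R |\<in>| ropts G \<Longrightarrow> oR nuL nuR (G \<oplus> X) \<le> oL nuL nuR (R \<oplus> X)"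
  "R |\<in>| ropts X \<Longrightarrow> oR nuL nuR (G \<oplus> X) \<le> oL nuL nuR (G \<oplus> R)"
  by (auto intro!: oR_le_oL' simp: ropts_gsum)

text \<open>This drives the later inductions: either Left cannot move in the sum and the outcome is
  read off the adorns, or a best move in one component realises it.\<close>

lemma oL_gsum_cases:
  assumes "G \<in> Omega A" "X \<in> Omega A"
  obtains (atomic) a b where "a \<in> A" "b \<in> A" "lside G = Atom a" "lside X = Atom b"
      "oL nuL nuR (G \<oplus> X) = nuL (a + b)"
    | (first) L where "L |\<in>| lopts G" "L \<in> Omega A" "oL nuL nuR (G \<oplus> X) = oR nuL nuR (L \<oplus> X)"
    | (second) L where "L |\<in>| lopts X" "L \<in> Omega A" "oL nuL nuR (G \<oplus> X) = oR nuL nuR (G \<oplus> L)"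
proof (cases "\<exists>K. K |\<in>| lopts (G \<oplus> X)")
  case True
  then obtain K where K: "K |\<in>| lopts (G \<oplus> X)" "oL nuL nuR (G \<oplus> X) = oR nuL nuR K"
    using oL_attained by blast
  then consider L where "L |\<in>| lopts G" "K = L \<oplus> X" | L where "L |\<in>| lopts X" "K = G \<oplus> L"
    by (auto simp: lopts_gsum)
  then show thesis
    using first second Omega_lopts assms K(2) by cases blast+
next
  case False
  then have "lopts G = {||}" "lopts X = {||}"
    by (auto simp: lopts_gsum)
  \<comment> \<open>The free space excludes \<open>Options {||}\<close>, so a side without options
    is an atom.\<close>
  then obtain a b where "a \<in> A" "b \<in> A" "lside G = Atom a" "lside X = Atom b"
    using Omega_lside_cases[OF assms(1)] Omega_lside_cases[OF assms(2)] by (metis fempty_iff)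
  then show thesis
    using atomic lside_gsum oL_Atom by metis
qed

lemma oR_gsum_cases:
  assumes "G \<in> Omega A" "X \<in> Omega A"
  obtains (atomic) a b where "a \<in> A" "b \<in> A" "rside G = Atom a" "rside X = Atom b"
      "oR nuL nuR (G \<oplus> X) = nuR (a + b)"
    | (first) R where "R |\<in>| ropts G" "R \<in> Omega A" "oR nuL nuR (G \<oplus> X) = oL nuL nuR (R \<oplus> X)"
    | (second) R where "R |\<in>| ropts X" "R \<in> Omega A" "oR nuL nuR (G \<oplus> X) = oL nuL nuR (G \<oplus> R)"
proof (cases "\<exists>K. K |\<in>| ropts (G \<oplus> X)")
  case True
  then obtain K where K: "K |\<in>| ropts (G \<oplus> X)" "oR nuL nuR (G \<oplus> X) = oL nuL nuR K"
    using oR_attained by blast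
  then consider R where "R |\<in>| ropts G" "K = R \<oplus> X" | R where "R |\<in>| ropts X" "K = G \<oplus> R"
    by (auto simp: ropts_gsum)
  then show thesis
    using first second Omega_ropts assms K(2) by cases blast+
next
  case False
  then have "ropts G = {||}" "ropts X = {||}"
    by (auto simp: ropts_gsum)
  then obtain a b where "a \<in> A" "b \<in> A" "rside G = Atom a" "rside X = Atom b"
    using Omega_rside_cases[OF assms(1)] Omega_rside_cases[OF assms(2)] by (metis fempty_iff)
  then show thesis
    using atomic rside_gsum oR_Atom by metis
qed

text \<open>Every play stops at a position where both components are atomic for the player to move,
  so its value is computed from one adorn of each. The two outcomes are treated together because
  they recurse through each other.\<close>

lemma outcome_gsum_adorns:
  assumes "G \<in> Omega A" "X \<in> Omega A"
  shows "oL nuL nuR (G \<oplus> X) \<in> (\<Union>a\<in>adorns G. \<Union>b\<in>adorns X. {nuL (a + b), nuR (a + b)}) \<and>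
    oR nuL nuR (G \<oplus> X) \<in> (\<Union>a\<in>adorns G. \<Union>b\<in>adorns X. {nuL (a + b), nuR (a + b)})"
    (is "_ \<in> ?V G X \<and> _")
  using assms
proof (induction "size G + size X" arbitrary: G X rule: less_induct)
  case less
  have IH1: "oL nuL nuR (K \<oplus> X) \<in> ?V G X \<and> oR nuL nuR (K \<oplus> X) \<in> ?V G X"
    if "K |\<in>| lopts G \<or> K |\<in>| ropts G" for K
  proof -
    have "oL nuL nuR (K \<oplus> X) \<in> ?V K X \<and> oR nuL nuR (K \<oplus> X) \<in> ?V K X"
      using that less.prems
      by (intro less.hyps) (auto dest: size_lopts size_ropts Omega_lopts Omega_ropts)
    then show ?thesis
      using adorns_option[OF _ that] by blast
  qed
  have IH2: "oL nuL nuR (G \<oplus> K) \<in> ?V G X \<and> oR nuL nuR (G \<oplus> K) \<in> ?V G X"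
    if "K |\<in>| lopts X \<or> K |\<in>| ropts X" for K
  proof -
    have "oL nuL nuR (G \<oplus> K) \<in> ?V G K \<and> oR nuL nuR (G \<oplus> K) \<in> ?V G K"
      using that less.prems
      by (intro less.hyps) (auto dest: size_lopts size_ropts Omega_lopts Omega_ropts)
    then show ?thesis
      using adorns_option[OF _ that] by blast
  qed
  have "oL nuL nuR (G \<oplus> X) \<in> ?V G X"
    using less.prems
  proof (cases rule: oL_gsum_cases[of G A X nuL nuR])
    case (atomic a b)
    then show ?thesis
      using adorns_lside[of G a] adorns_lside[of X b] by auto
  qed (use IH1 IH2 in simp_all)
  moreover have "oR nuL nuR (G \<oplus> X) \<in> ?V G X"
    using less.prems
  proof (cases rule: oR_gsum_cases[of G A X nuL nuR])
    case (atomic a b)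
    then show ?thesis
      using adorns_rside[of G a] adorns_rside[of X b] by auto
  qed (use IH1 IH2 in simp_all)
  ultimately show ?case
    by blast
qed

section \<open>Constant forms\<close>

lemma const_form_simps [simp]:
  "lside (const_form a) = Atom a" "rside (const_form a) = Atom a"
  "lopts (const_form a) = {||}" "ropts (const_form a) = {||}"
  by (simp_all add: const_form_def lopts_def ropts_def)

lemma const_form_Omega: "a \<in> A \<Longrightarrow> const_form a \<in> Omega A"
  by (rule Omega_I) auto

lemma form_eq_const_form: "lside X = Atom a \<Longrightarrow> rside X = Atom a \<Longrightarrow> X = const_form a"
  by (cases X) (simp add: const_form_def)

lemma Omega_0_eq_const_form:
  assumes "X \<in> Omega {0}" "left_atomic X" "right_atomic X"
  shows "X = const_form 0"
proof (rule form_eq_const_form)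
  show "lside X = Atom 0" "rside X = Atom 0"
    using assms Omega_lside_Atom[of X "{0}"] Omega_rside_Atom[of X "{0}"]
    by (auto simp: left_atomic_iff right_atomic_iff)
qed

lemma gsum_const_form_0: "G \<oplus> const_form (0::'a::monoid_add) = G"
proof (induction G rule: measure_induct_rule[of size])
  case (less G)
  have "(\<lambda>K. K \<oplus> const_form 0) |`| lopts G = lopts G"
    using less[OF size_lopts] fset.map_cong[of "lopts G" "lopts G" "\<lambda>K. K \<oplus> const_form 0" "\<lambda>K. K"]
    by simp
  moreover have "(\<lambda>K. K \<oplus> const_form 0) |`| ropts G = ropts G"
    using less[OF size_ropts] fset.map_cong[of "ropts G" "ropts G" "\<lambda>K. K \<oplus> const_form 0" "\<lambda>K. K"]
    by simp
  ultimately show ?case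
    by (cases G) (subst gsum.simps, auto simp: lopts_def ropts_def split: side.splits)
qed

text \<open>Nobody can move in a constant, so it shifts the final score of every play by
  \<open>a\<close>, and \<open>Max\<close> and \<open>Min\<close> commute with this monotone
  shift.\<close>

lemma outcome_gsum_const_form:
  assumes "G \<in> Omega UNIV"
  shows "oL scoring_nu scoring_nu (G \<oplus> const_form a) = oL scoring_nu scoring_nu G + a \<and>
    oR scoring_nu scoring_nu (G \<oplus> const_form a) = oR scoring_nu scoring_nu G + a"
  using assms
proof (induction G rule: measure_induct_rule[of size])
  case (less G)
  let ?oL = "oL scoring_nu scoring_nu" and ?oR = "oR scoring_nu scoring_nu"
  have mono: "mono (\<lambda>x::real. x + a)"
    by (simp add: mono_def)
  have "?oL (G \<oplus> const_form a) = ?oL G + a"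
    using less.prems
  proof (cases rule: Omega_lside_cases)
    case (Atom l)
    then show ?thesis
      using lside_gsum[of G l "const_form a" a] by (simp add: oL_Atom scoring_nu_def)
  next
    case (Option K)
    have "?oL (G \<oplus> const_form a) = Max (?oR ` (\<lambda>K. K \<oplus> const_form a) ` fset (lopts G))"
      using Option oL_Options[of "K \<oplus> const_form a" "G \<oplus> const_form a" scoring_nu scoring_nu]
      by (simp add: lopts_gsum)
    also have "?oR ` (\<lambda>K. K \<oplus> const_form a) ` fset (lopts G) = (\<lambda>x. x + a) ` ?oR ` fset (lopts G)"
      unfolding image_image using less size_lopts Omega_lopts by (intro image_cong) blast+
    also have "Max \<dots> = ?oL G + a"
      using Option by (subst mono_Max_commute[OF mono, symmetric]) (auto simp: oL_Options)
    finally show ?thesis .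
  qed
  moreover have "?oR (G \<oplus> const_form a) = ?oR G + a"
    using less.prems
  proof (cases rule: Omega_rside_cases)
    case (Atom l)
    then show ?thesis
      using rside_gsum[of G l "const_form a" a] by (simp add: oR_Atom scoring_nu_def)
  next
    case (Option K)
    have "?oR (G \<oplus> const_form a) = Min (?oL ` (\<lambda>K. K \<oplus> const_form a) ` fset (ropts G))"
      using Option oR_Options[of "K \<oplus> const_form a" "G \<oplus> const_form a" scoring_nu scoring_nu]
      by (simp add: ropts_gsum)
    also have "?oL ` (\<lambda>K. K \<oplus> const_form a) ` fset (ropts G) = (\<lambda>x. x + a) ` ?oL ` fset (ropts G)"
      unfolding image_image using less size_ropts Omega_ropts by (intro image_cong) blast+
    also have "Min \<dots> = ?oR G + a"
      using Option by (subst mono_Min_commute[OF mono, symmetric]) (auto simp: oR_Options)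
    finally show ?thesis .
  qed
  ultimately show ?case ..
qed

section \<open>Conjugates\<close>

lemma lside_conjugate: "lside (conjugate_form G) = map_side uminus conjugate_form (rside G)"
  and rside_conjugate: "rside (conjugate_form G) = map_side uminus conjugate_form (lside G)"
  by (cases G; simp)+

lemma lopts_conjugate: "lopts (conjugate_form G) = conjugate_form |`| ropts G"
  by (cases "rside G") (simp_all add: lopts_def ropts_def lside_conjugate)

lemma ropts_conjugate: "ropts (conjugate_form G) = conjugate_form |`| lopts G"
  by (cases "lside G") (simp_all add: lopts_def ropts_def rside_conjugate)

lemma conjugate_const_form_0 [simp]: "conjugate_form (const_form (0::'a::group_add)) = const_form 0"
  by (simp add: const_form_def)

text \<open>Conjugation exchanges the two sides uniformly, so the induction reduces to the options;
  for atoms the claim is that negation is additive.\<close>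

lemma conjugate_gsum:
  "conjugate_form (G \<oplus> H) = conjugate_form G \<oplus> conjugate_form (H :: 'a::ab_group_add form)"
proof (induction "size G + size H" arbitrary: G H rule: less_induct)
  case less
  \<comment> \<open>The Left options of the sum become Right options of its conjugate.
    \<open>L\<close> and \<open>R\<close> state the induction hypothesis on whole option sets, so
    that only the atom patterns remain to be checked.\<close>
  have L: "conjugate_form |`| ((\<lambda>K. K \<oplus> H) |`| lopts G |\<union>| (\<lambda>K. G \<oplus> K) |`| lopts H) =
      (\<lambda>K. K \<oplus> conjugate_form H) |`| conjugate_form |`| lopts G |\<union>|
      (\<lambda>K. conjugate_form G \<oplus> K) |`| conjugate_form |`| lopts H"
    unfolding fimage_funion fset.map_comp comp_def
    using less by (intro arg_cong2[of _ _ _ _ "(|\<union>|)"] fset.map_cong) (auto dest: size_lopts)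
  have R: "conjugate_form |`| ((\<lambda>K. K \<oplus> H) |`| ropts G |\<union>| (\<lambda>K. G \<oplus> K) |`| ropts H) =
      (\<lambda>K. K \<oplus> conjugate_form H) |`| conjugate_form |`| ropts G |\<union>|
      (\<lambda>K. conjugate_form G \<oplus> K) |`| conjugate_form |`| ropts H"
    unfolding fimage_funion fset.map_comp comp_def
    using less by (intro arg_cong2[of _ _ _ _ "(|\<union>|)"] fset.map_cong) (auto dest: size_ropts)
  show ?case
    unfolding gsum.simps[of G H] gsum.simps[of "conjugate_form G" "conjugate_form H"]
      lopts_conjugate ropts_conjugate lside_conjugate rside_conjugate L[symmetric] R[symmetric]
    by (cases "lside G"; cases "lside H"; cases "rside G"; cases "rside H") simp_all
qed

text \<open>The assumptions \<open>nu\<close> say that negating an adorn exchanges the values of the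
  two players. They hold for the constants of misere-play and for the identity of scoring-play.
  Negation then turns \<open>Max\<close> into \<open>Min\<close>.\<close>

lemma outcome_conjugate:
  fixes nuL nuR :: "'a::group_add \<Rightarrow> 's::linordered_ab_group_add"
  assumes nu: "\<And>a. nuL (- a) = - nuR a" "\<And>a. nuR (- a) = - nuL a"
    and "G \<in> Omega A"
  shows "oL nuL nuR (conjugate_form G) = - oR nuL nuR G \<and>
    oR nuL nuR (conjugate_form G) = - oL nuL nuR G"
  using assms(3)
proof (induction G rule: measure_induct_rule[of size])
  case (less G)
  let ?oL = "oL nuL nuR" and ?oR = "oR nuL nuR"
  have "?oL (conjugate_form G) = - ?oR G"
    using less.prems
  proof (cases rule: Omega_rside_cases)
    case (Atom a)
    then show ?thesis
      by (simp add: oL_Atom[of _ "- a"] oR_Atom[of G a] lside_conjugate nu)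
  next
    case (Option K)
    then have "?oL (conjugate_form G) = Max (?oR ` conjugate_form ` fset (ropts G))"
      using oL_Options[of "conjugate_form K" "conjugate_form G" nuL nuR]
      by (simp add: lopts_conjugate)
    also have "?oR ` conjugate_form ` fset (ropts G) = uminus ` ?oL ` fset (ropts G)"
      unfolding image_image using less size_ropts Omega_ropts by (intro image_cong) blast+
    also have "Max \<dots> = - ?oR G"
      using Option by (subst minus_Min_eq_Max[symmetric]) (auto simp: oR_Options)
    finally show ?thesis .
  qed
  moreover have "?oR (conjugate_form G) = - ?oL G"
    using less.prems
  proof (cases rule: Omega_lside_cases)
    case (Atom a)
    then show ?thesis
      by (simp add: oR_Atom[of _ "- a"] oL_Atom[of G a] rside_conjugate nu)
  next
    case (Option K)
    then have "?oR (conjugate_form G) = Min (?oL ` conjugate_form ` fset (lopts G))"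
      using oR_Options[of "conjugate_form K" "conjugate_form G" nuL nuR]
      by (simp add: ropts_conjugate)
    also have "?oL ` conjugate_form ` fset (lopts G) = uminus ` ?oR ` fset (lopts G)"
      unfolding image_image using less size_lopts Omega_lopts by (intro image_cong) blast+
    also have "Min \<dots> = - ?oL G"
      using Option by (subst minus_Max_eq_Min[symmetric]) (auto simp: oL_Options)
    finally show ?thesis .
  qed
  ultimately show ?case ..
qed

section \<open>Maintenance reduces the order to atomic positions\<close>

text \<open>A move in \<open>G\<close> or \<open>H\<close> leads to positions that the Maintenance
  already compares for every summand, so only copied moves in \<open>X\<close> call on the
  induction. \<open>left\<close> and \<open>right\<close> isolate the positions in which there is no
  move to answer; the component compared with the atomic one may still have options.\<close>

lemma game_ge_if_maintenance:
  assumes "universe A U" "G \<in> U" "H \<in> U" "maintenance nuL nuR U G H"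
    and left: "\<And>X h x. X \<in> U \<Longrightarrow> lside H = Atom h \<Longrightarrow> lside X = Atom x \<Longrightarrow>
      nuL (h + x) \<le> oL nuL nuR (G \<oplus> X)"
    and right: "\<And>X g x. X \<in> U \<Longrightarrow> rside G = Atom g \<Longrightarrow> rside X = Atom x \<Longrightarrow>
      oR nuL nuR (H \<oplus> X) \<le> nuR (g + x)"
  shows "game_ge nuL nuR U G H"
proof -
  let ?oL = "oL nuL nuR" and ?oR = "oR nuL nuR"
  have U: "U \<subseteq> Omega A" "\<And>G K. G \<in> U \<Longrightarrow> K |\<in>| lopts G \<Longrightarrow> K \<in> U"
    "\<And>G K. G \<in> U \<Longrightarrow> K |\<in>| ropts G \<Longrightarrow> K \<in> U"
    using assms(1) by (auto simp: universe_def)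
  have ge: "?oL (K' \<oplus> X) \<le> ?oL (K \<oplus> X)" "?oR (K' \<oplus> X) \<le> ?oR (K \<oplus> X)"
    if "game_ge nuL nuR U K K'" "X \<in> U" for K K' X
    using that by (auto simp: game_ge_def outcome_ge_def)
  have "?oL (H \<oplus> X) \<le> ?oL (G \<oplus> X) \<and> ?oR (H \<oplus> X) \<le> ?oR (G \<oplus> X)" if "X \<in> U" for X
    using that
  proof (induction X rule: measure_induct_rule[of size])
    case (less X)
    have Om: "G \<in> Omega A" "H \<in> Omega A" "X \<in> Omega A"
      using U(1) assms less.prems by auto
    have "?oL (H \<oplus> X) \<le> ?oL (G \<oplus> X)"
      using Om(2,3)
    proof (cases rule: oL_gsum_cases[of H A X nuL nuR])
      case (atomic a b)
      then show ?thesis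
        using left less.prems by auto
    next
      \<comment> \<open>A matching move gives \<open>?oR (HL \<oplus> X) \<le> ?oR (GL \<oplus> X)
        \<le> ?oL (G \<oplus> X)\<close>; a reversing one gives \<open>?oR (HL \<oplus> X) \<le> ?oL
        (HLR \<oplus> X) \<le> ?oL (G \<oplus> X)\<close>.\<close>
      case (first HL)
      then consider GL where "GL |\<in>| lopts G" "game_ge nuL nuR U GL HL"
        | HLR where "HLR |\<in>| ropts HL" "game_ge nuL nuR U G HLR"
        using assms(4) unfolding maintenance_def by blast
      then show ?thesis
      proof cases
        case 1
        then show ?thesis
          using first ge(2)[OF 1(2) less.prems] oL_gsum_ge(1)[OF 1(1), of nuL nuR X] by order
      next
        case 2
        then show ?thesis
          using first ge(1)[OF 2(2) less.prems] oR_gsum_le(1)[OF 2(1), of nuL nuR X] by order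
      qed
    next
      case (second L)
      then have "?oR (H \<oplus> L) \<le> ?oR (G \<oplus> L)"
        using less U(2) size_lopts by blast
      then show ?thesis
        using second oL_gsum_ge(2)[OF second(1), of nuL nuR G] by order
    qed
    \<comment> \<open>Right minimises, so here a best move in \<open>G \<oplus> X\<close>, the
      larger side, has to be answered.\<close>
    moreover have "?oR (H \<oplus> X) \<le> ?oR (G \<oplus> X)"
      using Om(1,3)
    proof (cases rule: oR_gsum_cases[of G A X nuL nuR])
      case (atomic a b)
      then show ?thesis
        using right less.prems by auto
    next
      \<comment> \<open>Either \<open>?oR (H \<oplus> X) \<le> ?oL (HR \<oplus> X) \<le> ?oL (GR
        \<oplus> X)\<close>, or \<open>?oR (H \<oplus> X) \<le> ?oR (GRL \<oplus> X) \<le> ?oL (GR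
        \<oplus> X)\<close>.\<close>
      case (first GR)
      then consider HR where "HR |\<in>| ropts H" "game_ge nuL nuR U GR HR"
        | GRL where "GRL |\<in>| lopts GR" "game_ge nuL nuR U GRL H"
        using assms(4) unfolding maintenance_def by blast
      then show ?thesis
      proof cases
        case 1
        then show ?thesis
          using first ge(1)[OF 1(2) less.prems] oR_gsum_le(1)[OF 1(1), of nuL nuR X] by order
      next
        case 2
        then show ?thesis
          using first ge(2)[OF 2(2) less.prems] oL_gsum_ge(1)[OF 2(1), of nuL nuR X] by order
      qed
    next
      case (second R)
      then have "?oL (H \<oplus> R) \<le> ?oL (G \<oplus> R)"
        using less U(3) size_ropts by blast
      then show ?thesis
        using second oR_gsum_le(2)[OF second(1), of nuL nuR H] by order
    qed
    ultimately show ?case ..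
  qed
  then show ?thesis
    by (simp add: game_ge_def outcome_ge_def)
qed

section \<open>Waiting games\<close>

lemma protected_oL_ge_Atom:
  fixes w :: "nat \<Rightarrow> 'a::monoid_add form"
  assumes "G \<in> Omega A" "\<And>n. w n \<in> Omega A" "\<And>n. adorns (w n) \<subseteq> {0}"
    and w: "\<And>n. lside (w n) = Atom 0" and "lside H = Atom h"
    and ge: "protected_oL nuL nuR w H \<le> protected_oL nuL nuR w G"
  shows "nuL h \<le> oL nuL nuR (G \<oplus> w n)"
proof -
  \<comment> \<open>All adorns of \<open>w n\<close> are 0, so this set of candidate values does not
    depend on \<open>n\<close>. It is finite, which makes \<open>Min\<close> a true lower bound of
    the range.\<close>
  have "oL nuL nuR (G \<oplus> w n) \<in> (\<Union>a\<in>adorns G. {nuL a, nuR a})" for n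
    using outcome_gsum_adorns[OF assms(1,2), of nuL nuR n] assms(3)[of n] by force
  then have "range (\<lambda>n. oL nuL nuR (G \<oplus> w n)) \<subseteq> (\<Union>a\<in>adorns G. {nuL a, nuR a})"
    by blast
  then have "finite (range (\<lambda>n. oL nuL nuR (G \<oplus> w n)))"
    by (rule finite_subset) (simp add: finite_adorns)
  then have "protected_oL nuL nuR w G \<le> oL nuL nuR (G \<oplus> w n)"
    unfolding protected_oL_def by (intro Min_le) auto
  \<comment> \<open>Left has no move in \<open>H \<oplus> w n\<close>, so the range is the single
    value \<open>nuL h\<close>.\<close>
  moreover have "protected_oL nuL nuR w H = nuL h"
    using lside_gsum[OF assms(5) w] by (simp add: protected_oL_def oL_Atom)
  ultimately show ?thesis
    using ge by simp
qed

lemma protected_oR_ge_Atom: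
  fixes w :: "nat \<Rightarrow> 'a::monoid_add form"
  assumes "H \<in> Omega A" "\<And>n. w n \<in> Omega A" "\<And>n. adorns (w n) \<subseteq> {0}"
    and w: "\<And>n. rside (w n) = Atom 0" and "rside G = Atom g"
    and ge: "protected_oR nuL nuR w H \<le> protected_oR nuL nuR w G"
  shows "oR nuL nuR (H \<oplus> w n) \<le> nuR g"
proof -
  have "oR nuL nuR (H \<oplus> w n) \<in> (\<Union>a\<in>adorns H. {nuL a, nuR a})" for n
    using outcome_gsum_adorns[OF assms(1,2), of nuL nuR n] assms(3)[of n] by force
  then have "range (\<lambda>n. oR nuL nuR (H \<oplus> w n)) \<subseteq> (\<Union>a\<in>adorns H. {nuL a, nuR a})"
    by blast
  then have "finite (range (\<lambda>n. oR nuL nuR (H \<oplus> w n)))"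
    by (rule finite_subset) (simp add: finite_adorns)
  then have "oR nuL nuR (H \<oplus> w n) \<le> protected_oR nuL nuR w H"
    unfolding protected_oR_def by (intro Max_ge) auto
  moreover have "protected_oR nuL nuR w G = nuR g"
    using rside_gsum[OF assms(5) w] by (simp add: protected_oR_def oR_Atom)
  ultimately show ?thesis
    using ge by simp
qed

section \<open>Elementary facts on waiting games\<close>

lemma waits_Omega:
  "dead_lower_wait n \<in> Omega {0}" "dead_upper_wait n \<in> Omega {0}"
  "score_lower_wait n \<in> Omega UNIV" "score_upper_wait n \<in> Omega UNIV"
  by (induction n)
    (auto simp: const_form_Omega lopts_def ropts_def intro!: Omega_I[of _ "Form _ _"])

lemma adorns_const_form: "adorns (const_form a) = {a}"
  by (subst adorns_unfold) auto

lemma adorns_waits: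
  "adorns (dead_lower_wait n) \<subseteq> {0}" "adorns (dead_upper_wait n) \<subseteq> {0}"
  "adorns (score_lower_wait n) \<subseteq> {0}" "adorns (score_upper_wait n) \<subseteq> {0}"
  by (induction n)
    (simp_all add: adorns_const_form adorns_unfold[of "Form _ _"] lopts_def ropts_def)

lemma lside_lower_waits [simp]:
  "lside (dead_lower_wait n) = Atom 0" "lside (score_lower_wait n) = Atom 0"
  by (cases n; simp)+

lemma rside_upper_waits [simp]:
  "rside (dead_upper_wait n) = Atom 0" "rside (score_upper_wait n) = Atom 0"
  by (cases n; simp)+

lemma lopts_lower_waits [simp]:
  "lopts (dead_lower_wait n) = {||}" "lopts (score_lower_wait n) = {||}"
  by (simp_all add: lopts_def)

lemma conjugate_upper_waits:
  "conjugate_form (dead_upper_wait n) = dead_lower_wait n"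
  "conjugate_form (score_upper_wait n) = score_lower_wait n"
  by (induction n) simp_all

section \<open>Dead-ending misere-play: Left-atomic summands against waiting games\<close>

text \<open>The hypothesis that \<open>X\<close> has a Right option is essential: if \<open>K = X = const_form 0\<close>, then
  Right, moving first, wins \<open>K \<oplus> X\<close> at once but loses \<open>K \<oplus> dead_lower_wait n\<close> for \<open>n > 0\<close>.\<close>

lemma dead_lower_wait_le:
  assumes "K \<in> Omega {0}" "X \<in> Omega {0}" "\<And>F. F \<in> followers X \<Longrightarrow> left_atomic F"
    "\<not> right_atomic X" "size X \<le> n"
  shows "oL misere_nuL misere_nuR (K \<oplus> dead_lower_wait n) \<le> oL misere_nuL misere_nuR (K \<oplus> X) \<and>
    oR misere_nuL misere_nuR (K \<oplus> dead_lower_wait n) \<le> oR misere_nuL misere_nuR (K \<oplus> X)"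
  using assms
proof (induction "size K + size X" arbitrary: K X n rule: less_induct)
  case less
  let ?oL = "oL misere_nuL misere_nuR" and ?oR = "oR misere_nuL misere_nuR"
  \<comment> \<open>Forms have positive size, so \<open>size X \<le> n\<close> leaves at least one
    waiting move.\<close>
  obtain m where m: "n = Suc m"
    using less.prems(5) by (cases n; cases X) auto
  obtain x where x: "lside X = Atom x"
    using less.prems(3)[OF followers.self] by (auto simp: left_atomic_iff)
  have "?oL (K \<oplus> dead_lower_wait n) \<le> ?oL (K \<oplus> X)"
    using less.prems(1) waits_Omega(1)
  proof (cases rule: oL_gsum_cases[of K "{0}" "dead_lower_wait n" misere_nuL misere_nuR])
    \<comment> \<open>\<open>X\<close> is Left-atomic too, so Left is out of moves in both sums and
      both values are 1.\<close>
    case (atomic a b)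
    then show ?thesis
      using lside_gsum[OF atomic(3) x] by (simp add: oL_Atom misere_nuL_def)
  next
    case (first L)
    then have "?oR (L \<oplus> dead_lower_wait n) \<le> ?oR (L \<oplus> X)"
      using less.hyps[of L X n] less.prems size_lopts by auto
    then show ?thesis
      using first oL_gsum_ge(1)[OF first(1), of misere_nuL misere_nuR X] by simp
  \<comment> \<open>The remaining case is vacuous, since a waiting game has no Left option.\<close>
  qed simp
  moreover have "?oR (K \<oplus> dead_lower_wait n) \<le> ?oR (K \<oplus> X)"
    using less.prems(1,2)
  proof (cases rule: oR_gsum_cases[of K "{0}" X misere_nuL misere_nuR])
    case (atomic a b)
    then show ?thesis
      using less.prems(4) by (simp add: right_atomic_iff)
  next
    case (first R)
    then have "?oL (R \<oplus> dead_lower_wait n) \<le> ?oL (R \<oplus> X)"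
      using less.hyps[of R X n] less.prems size_ropts by auto
    then show ?thesis
      using first oR_gsum_le(1)[OF first(1), of misere_nuL misere_nuR "dead_lower_wait n"]
      by simp
  next
    case (second R)
    have R: "left_atomic F" if "F \<in> followers R" for F
      using less.prems(3) followers_option[OF that] second(1) by blast
    show ?thesis
    proof (cases "right_atomic R")
      \<comment> \<open>The induction hypothesis excludes a Right-atomic \<open>R\<close>. Such an
        \<open>R\<close> is zero, and Right can match it because zero is itself an option of
        \<open>dead_lower_wait (Suc m)\<close>.\<close>
      case True
      then have "R = const_form 0"
        using R[OF followers.self] second(2) by (intro Omega_0_eq_const_form)
      then have "R |\<in>| ropts (dead_lower_wait n)"
        by (simp add: m ropts_def)
      then show ?thesis
        using second oR_gsum_le(2) by metis
    next
      case False
      \<comment> \<open>Since \<open>size R < size X \<le> Suc m\<close>, the \<open>m\<close>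
        waiting moves that are left suffice for \<open>R\<close>.\<close>
      then have "?oL (K \<oplus> dead_lower_wait m) \<le> ?oL (K \<oplus> R)"
        using less.hyps[of K R m] less.prems size_ropts[OF second(1)] second R m by auto
      moreover have "?oR (K \<oplus> dead_lower_wait n) \<le> ?oL (K \<oplus> dead_lower_wait m)"
        by (rule oR_gsum_le(2)) (simp add: m ropts_def)
      ultimately show ?thesis
        using second by simp
    qed
  qed
  ultimately show ?case ..
qed

text \<open>A Left-atomic dead-ending \<open>X\<close> is Left-atomic in all its followers. If it is
  Right-atomic as well, it is the waiting game with \<open>n = 0\<close>; otherwise
  \<open>n = size X\<close> gives Right enough waiting moves.\<close>

lemma dead_lower_wait_bound:
  assumes "G \<in> Omega {0}" "X \<in> dead_ending_misere" "lside X = Atom x"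
  shows "\<exists>n. oL misere_nuL misere_nuR (G \<oplus> dead_lower_wait n) \<le> oL misere_nuL misere_nuR (G \<oplus> X)"
proof (cases "right_atomic X")
  case True
  have "X \<in> Omega {0}"
    using assms(2) by (simp add: dead_ending_misere_def)
  then have "X = dead_lower_wait 0"
    using True assms(3) Omega_0_eq_const_form[of X] by (simp add: left_atomic_iff)
  then show ?thesis
    by blast
next
  case False
  then show ?thesis
    using assms dead_lower_wait_le[of G X "size X"] followers.self[of X]
    unfolding dead_ending_misere_def left_atomic_iff by blast
qed

section \<open>Guaranteed scoring-play: summands with bounded adorns against waiting games\<close>

lemma guaranteed_scoring_adorns:
  assumes "K \<in> guaranteed_scoring"
  shows "lside K = Atom l \<Longrightarrow> a \<in> adorns K \<Longrightarrow> l \<le> a"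
    and "rside K = Atom r \<Longrightarrow> a \<in> adorns K \<Longrightarrow> a \<le> r"
  using assms followers.self[of K] unfolding guaranteed_scoring_def adorns_def by blast+

lemma guaranteed_scoring_option:
  assumes "K \<in> guaranteed_scoring" "K' |\<in>| lopts K \<or> K' |\<in>| ropts K"
  shows "K' \<in> guaranteed_scoring"
  using assms followers_option[OF _ assms(2)] Omega_lopts Omega_ropts
  unfolding guaranteed_scoring_def by blast

text \<open>Left plays in \<open>K\<close> as she would beside the waiting game, and each Right move
  in \<open>X\<close> is mirrored by one waiting move. The guarantee on \<open>K\<close> settles the
  positions where a player has no move left in \<open>K\<close>. A lower bound on adorns is assumed
  of \<open>X\<close> because it passes to options, whereas being Left-atomic need not.\<close>

lemma score_lower_wait_le:
  assumes "K \<in> guaranteed_scoring" "X \<in> Omega UNIV" "\<And>a. a \<in> adorns X \<Longrightarrow> x \<le> a" "size X \<le> n"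
  shows "oL scoring_nu scoring_nu (K \<oplus> score_lower_wait n) + x \<le> oL scoring_nu scoring_nu (K \<oplus> X) \<and>
    oR scoring_nu scoring_nu (K \<oplus> score_lower_wait n) + x \<le> oR scoring_nu scoring_nu (K \<oplus> X)"
  using assms
proof (induction "size K + size X" arbitrary: K X n rule: less_induct)
  case less
  let ?oL = "oL scoring_nu scoring_nu" and ?oR = "oR scoring_nu scoring_nu"
  obtain m where m: "n = Suc m"
    using less.prems(4) by (cases n; cases X) auto
  have K: "K \<in> Omega UNIV"
    using less.prems(1) by (simp add: guaranteed_scoring_def)
  have "?oL (K \<oplus> score_lower_wait n) + x \<le> ?oL (K \<oplus> X)"
    using K waits_Omega(3)
  proof (cases rule: oL_gsum_cases[of K UNIV "score_lower_wait n" scoring_nu scoring_nu])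
    case (atomic a b)
    \<comment> \<open>Whatever happens in \<open>K \<oplus> X\<close>, its value is a sum of two
      adorns, and Left's guarantee in \<open>K\<close> together with the bound on \<open>X\<close>
      makes it at least \<open>a + x\<close>.\<close>
    obtain c d where "c \<in> adorns K" "d \<in> adorns X" "?oL (K \<oplus> X) = c + d"
      using outcome_gsum_adorns[OF K less.prems(2), of scoring_nu scoring_nu]
      by (auto simp: scoring_nu_def)
    moreover have "a \<le> c"
      using guaranteed_scoring_adorns(1)[OF less.prems(1) atomic(3)] \<open>c \<in> adorns K\<close> .
    ultimately show ?thesis
      using atomic less.prems(3)[of d] by (simp add: scoring_nu_def)
  next
    case (first L)
    then have "?oR (L \<oplus> score_lower_wait n) + x \<le> ?oR (L \<oplus> X)"
      using less.hyps[of L X n] less.prems size_lopts guaranteed_scoring_option by auto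
    then show ?thesis
      using first oL_gsum_ge(1)[OF first(1), of scoring_nu scoring_nu X] by simp
  qed simp
  moreover have "?oR (K \<oplus> score_lower_wait n) + x \<le> ?oR (K \<oplus> X)"
    using K less.prems(2)
  proof (cases rule: oR_gsum_cases[of K UNIV X scoring_nu scoring_nu])
    case (atomic a b)
    \<comment> \<open>Right may still have waiting moves here, but the value reached is an adorn
      \<open>c\<close> of \<open>K\<close>, and Right's guarantee gives
      \<open>c \<le> a\<close>.\<close>
    obtain c where "c \<in> adorns K" "?oR (K \<oplus> score_lower_wait n) = c"
      using outcome_gsum_adorns[OF K waits_Omega(3), of scoring_nu scoring_nu n] adorns_waits(3)[of n]
      by (force simp: scoring_nu_def)
    moreover have "c \<le> a"
      using guaranteed_scoring_adorns(2)[OF less.prems(1) atomic(3)] \<open>c \<in> adorns K\<close> .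
    ultimately show ?thesis
      using atomic(5) less.prems(3)[OF adorns_rside[OF atomic(4)]] by (simp add: scoring_nu_def)
  next
    case (first R)
    then have "?oL (R \<oplus> score_lower_wait n) + x \<le> ?oL (R \<oplus> X)"
      using less.hyps[of R X n] less.prems size_ropts guaranteed_scoring_option by auto
    then show ?thesis
      using first oR_gsum_le(1)[OF first(1), of scoring_nu scoring_nu "score_lower_wait n"] by simp
  next
    case (second R)
    have "x \<le> a" if "a \<in> adorns R" for a
      using less.prems(3) adorns_option[OF that] second(1) by blast
    then have "?oL (K \<oplus> score_lower_wait m) + x \<le> ?oL (K \<oplus> R)"
      using less.hyps[of K R m] less.prems(1,4) size_ropts[OF second(1)] second m by auto
    moreover have "?oR (K \<oplus> score_lower_wait n) \<le> ?oL (K \<oplus> score_lower_wait m)"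
      by (rule oR_gsum_le(2)) (simp add: m ropts_def)
    ultimately show ?thesis
      using second by simp
  qed
  ultimately show ?case ..
qed

lemma score_lower_wait_bound:
  assumes "G \<in> guaranteed_scoring" "X \<in> guaranteed_scoring" "lside X = Atom x"
  shows "\<exists>n. oL scoring_nu scoring_nu (G \<oplus> score_lower_wait n) + x \<le> oL scoring_nu scoring_nu (G \<oplus> X)"
  \<comment> \<open>\<open>order_refl\<close> selects \<open>n = size X\<close>; the guarantee at
    \<open>X\<close> itself bounds its adorns below by \<open>x\<close>.\<close>
  using score_lower_wait_le[OF assms(1) _ guaranteed_scoring_adorns(1)[OF assms(2,3)] order_refl]
    assms(2) by (auto simp: guaranteed_scoring_def)

section \<open>The bounds for Right, by conjugation\<close>

lemma dead_upper_wait_bound: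
  assumes U: "universe {0} dead_ending_misere"
    and "G \<in> dead_ending_misere" "X \<in> dead_ending_misere" "rside X = Atom x"
  shows "\<exists>n. oR misere_nuL misere_nuR (G \<oplus> X) \<le> oR misere_nuL misere_nuR (G \<oplus> dead_upper_wait n)"
proof -
  let ?oL = "oL misere_nuL misere_nuR" and ?oR = "oR misere_nuL misere_nuR"
  have Om: "K \<in> Omega {0}" if "K \<in> dead_ending_misere" for K
    using that by (simp add: dead_ending_misere_def)
  have conj: "?oL (conjugate_form G \<oplus> conjugate_form K) = - ?oR (G \<oplus> K)" if "K \<in> Omega {0}" for K
    using outcome_conjugate[of misere_nuL misere_nuR "G \<oplus> K"]
      gsum_Omega[OF _ Om[OF assms(2)] that]
    by (simp add: conjugate_gsum misere_nuL_def misere_nuR_def)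
  \<comment> \<open>Closure under conjugation is taken from the universe assumption
    \<open>U\<close>.\<close>
  have "conjugate_form G \<in> dead_ending_misere" "conjugate_form X \<in> dead_ending_misere"
    using U assms(2,3) by (auto simp: universe_def)
  then obtain n where
    "?oL (conjugate_form G \<oplus> dead_lower_wait n) \<le> ?oL (conjugate_form G \<oplus> conjugate_form X)"
    using dead_lower_wait_bound[OF Om, of "conjugate_form G" "conjugate_form X" "- x"] assms(4)
    by (auto simp: lside_conjugate)
  then show ?thesis
    using conj[OF Om[OF assms(3)]] conj[OF waits_Omega(2), of n]
    by (auto simp: conjugate_upper_waits)
qed

lemma score_upper_wait_bound:
  assumes U: "universe UNIV guaranteed_scoring"
    and "G \<in> guaranteed_scoring" "X \<in> guaranteed_scoring" "rside X = Atom x"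
  shows "\<exists>n. oR scoring_nu scoring_nu (G \<oplus> X) \<le> oR scoring_nu scoring_nu (G \<oplus> score_upper_wait n) + x"
proof -
  let ?oL = "oL scoring_nu scoring_nu" and ?oR = "oR scoring_nu scoring_nu"
  have Om: "K \<in> Omega UNIV" if "K \<in> guaranteed_scoring" for K
    using that by (simp add: guaranteed_scoring_def)
  have conj: "?oL (conjugate_form G \<oplus> conjugate_form K) = - ?oR (G \<oplus> K)" if "K \<in> Omega UNIV" for K
    using outcome_conjugate[of scoring_nu scoring_nu "G \<oplus> K"]
      gsum_Omega[OF _ Om[OF assms(2)] that]
    by (simp add: conjugate_gsum scoring_nu_def)
  have "conjugate_form G \<in> guaranteed_scoring" "conjugate_form X \<in> guaranteed_scoring"
    using U assms(2,3) by (auto simp: universe_def)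
  \<comment> \<open>The Right adorn \<open>x\<close> of \<open>X\<close> becomes the Left adorn
    \<open>- x\<close> of its conjugate; negating the resulting inequality restores
    \<open>+ x\<close>.\<close>
  then obtain n where
    "?oL (conjugate_form G \<oplus> score_lower_wait n) + - x \<le> ?oL (conjugate_form G \<oplus> conjugate_form X)"
    using score_lower_wait_bound[of "conjugate_form G" "conjugate_form X" "- x"] assms(4)
    by (auto simp: lside_conjugate)
  then have "?oR (G \<oplus> X) \<le> ?oR (G \<oplus> score_upper_wait n) + x"
    using conj[OF Om[OF assms(3)]] conj[OF waits_Omega(4), of n]
    by (simp add: conjugate_upper_waits)
  then show ?thesis ..
qed

section \<open>The specific universes\<close>

text \<open>A player who cannot move loses: \<open>normal_nuL\<close> is the least possible outcome
  and \<open>normal_nuR\<close> the greatest, so the atomic positions impose no condition.\<close>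

lemma game_ge_normal_play:
  assumes "universe {0} normal_play" "G \<in> normal_play" "H \<in> normal_play"
    and "maintenance normal_nuL normal_nuR normal_play G H"
  shows "game_ge normal_nuL normal_nuR normal_play G H"
proof (rule game_ge_if_maintenance[OF assms])
  fix X :: "int form" and a x
  assume "X \<in> normal_play"
  then have Om: "G \<in> Omega {0}" "H \<in> Omega {0}" "X \<in> Omega {0}"
    using assms(2,3) by (auto simp: normal_play_def)
  show "normal_nuL (a + x) \<le> oL normal_nuL normal_nuR (G \<oplus> X)"
    using outcome_gsum_adorns[OF Om(1,3), of normal_nuL normal_nuR]
    by (elim conjE UN_E) (auto simp: normal_nuL_def normal_nuR_def)
  show "oR normal_nuL normal_nuR (H \<oplus> X) \<le> normal_nuR (a + x)"
    using outcome_gsum_adorns[OF Om(2,3), of normal_nuL normal_nuR]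
    by (elim conjE UN_E) (auto simp: normal_nuL_def normal_nuR_def)
qed

text \<open>A dicot \<open>X\<close> that is atomic on one side is zero, so the atomic positions
  only compare \<open>G\<close> with \<open>H\<close> themselves, which is the assumption on
  outcomes.\<close>

lemma game_ge_dicot_misere:
  assumes "universe {0} dicot_misere" "G \<in> dicot_misere" "H \<in> dicot_misere"
    and "maintenance misere_nuL misere_nuR dicot_misere G H"
    and ge: "outcome_ge misere_nuL misere_nuR G H"
  shows "game_ge misere_nuL misere_nuR dicot_misere G H"
proof (rule game_ge_if_maintenance[OF assms(1-4)])
  fix X :: "int form" and x
  assume X: "X \<in> dicot_misere"
  have const: "X = const_form 0" if "left_atomic X \<or> right_atomic X"
    using X that followers.self[of X] Omega_0_eq_const_form[of X]
    unfolding dicot_misere_def by blast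
  show "misere_nuL (h + x) \<le> oL misere_nuL misere_nuR (G \<oplus> X)"
    if "lside H = Atom h" "lside X = Atom x" for h
    using ge that const oL_Atom[OF that(1), of misere_nuL misere_nuR]
    by (simp add: left_atomic_iff gsum_const_form_0 outcome_ge_def misere_nuL_def)
  show "oR misere_nuL misere_nuR (H \<oplus> X) \<le> misere_nuR (g + x)"
    if "rside G = Atom g" "rside X = Atom x" for g
    using ge that const oR_Atom[OF that(1), of misere_nuL misere_nuR]
    by (simp add: right_atomic_iff gsum_const_form_0 outcome_ge_def misere_nuR_def)
qed

lemma game_ge_dead_ending_misere:
  assumes U: "universe {0} dead_ending_misere"
    and G: "G \<in> dead_ending_misere" and H: "H \<in> dead_ending_misere"
    and m: "maintenance misere_nuL misere_nuR dead_ending_misere G H"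
    and geL: "protected_oL misere_nuL misere_nuR dead_lower_wait H
      \<le> protected_oL misere_nuL misere_nuR dead_lower_wait G"
    and geR: "protected_oR misere_nuL misere_nuR dead_upper_wait H
      \<le> protected_oR misere_nuL misere_nuR dead_upper_wait G"
  shows "game_ge misere_nuL misere_nuR dead_ending_misere G H"
proof (rule game_ge_if_maintenance[OF U G H m])
  have Om: "G \<in> Omega {0}" "H \<in> Omega {0}"
    using G H by (auto simp: dead_ending_misere_def)
  fix X :: "int form" and x
  assume X: "X \<in> dead_ending_misere"
  show "misere_nuL (h + x) \<le> oL misere_nuL misere_nuR (G \<oplus> X)"
    if side: "lside H = Atom h" and x: "lside X = Atom x" for h
  proof -
    \<comment> \<open>The chain is \<open>misere_nuL h \<le> oL (G \<oplus> wait) \<le> oL (G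
      \<oplus> X)\<close>: first the protected outcomes, then the waiting bound.\<close>
    obtain n where "oL misere_nuL misere_nuR (G \<oplus> dead_lower_wait n)
        \<le> oL misere_nuL misere_nuR (G \<oplus> X)"
      using dead_lower_wait_bound[OF Om(1) X x] by blast
    then show ?thesis
      using protected_oL_ge_Atom[OF Om(1) waits_Omega(1) adorns_waits(1) _ side geL, of n]
      by (simp add: misere_nuL_def)
  qed
  show "oR misere_nuL misere_nuR (H \<oplus> X) \<le> misere_nuR (g + x)"
    if side: "rside G = Atom g" and x: "rside X = Atom x" for g
  proof -
    obtain n where "oR misere_nuL misere_nuR (H \<oplus> X)
        \<le> oR misere_nuL misere_nuR (H \<oplus> dead_upper_wait n)"
      using dead_upper_wait_bound[OF U H X x] by blast
    then show ?thesis
      using protected_oR_ge_Atom[OF Om(2) waits_Omega(2) adorns_waits(2) _ side geR, of n]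
      by (simp add: misere_nuR_def)
  qed
qed

lemma game_ge_free_misere:
  assumes "universe {0} free_misere" "G \<in> free_misere" "H \<in> free_misere"
    and "maintenance misere_nuL misere_nuR free_misere G H"
    and L: "lside H = Atom 0 \<longrightarrow> lside G = Atom 0"
    and R: "rside G = Atom 0 \<longrightarrow> rside H = Atom 0"
  shows "game_ge misere_nuL misere_nuR free_misere G H"
proof (rule game_ge_if_maintenance[OF assms(1-4)])
  have Om: "G \<in> Omega {0}" "H \<in> Omega {0}"
    using assms(2,3) by (auto simp: free_misere_def)
  fix X :: "int form" and x
  show "misere_nuL (h + x) \<le> oL misere_nuL misere_nuR (G \<oplus> X)"
    if "lside H = Atom h" "lside X = Atom x" for h
    \<comment> \<open>The carrier \<open>{0}\<close> forces \<open>h = 0\<close>, so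
      \<open>L\<close> applies; then \<open>G \<oplus> X\<close> is Left-atomic and Left wins it
      moving first.\<close>
    using L that Omega_lside_Atom[OF Om(2) that(1)] lside_gsum[of G 0 X x]
    by (simp add: oL_Atom misere_nuL_def)
  show "oR misere_nuL misere_nuR (H \<oplus> X) \<le> misere_nuR (g + x)"
    if "rside G = Atom g" "rside X = Atom x" for g
    using R that Omega_rside_Atom[OF Om(1) that(1)] rside_gsum[of H 0 X x]
    by (simp add: oR_Atom misere_nuR_def)
qed

text \<open>A dicot \<open>X\<close> with an atomic side is a constant, which shifts the outcomes of
  both sums by the same amount.\<close>

lemma game_ge_dicot_scoring:
  assumes "universe UNIV dicot_scoring" "G \<in> dicot_scoring" "H \<in> dicot_scoring"
    and "maintenance scoring_nu scoring_nu dicot_scoring G H"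
    and ge: "outcome_ge scoring_nu scoring_nu G H"
  shows "game_ge scoring_nu scoring_nu dicot_scoring G H"
proof (rule game_ge_if_maintenance[OF assms(1-4)])
  have Om: "G \<in> Omega UNIV" "H \<in> Omega UNIV"
    using assms(2,3) by (auto simp: dicot_scoring_def)
  fix X :: "real form" and x
  assume X: "X \<in> dicot_scoring"
  have const: "X = const_form x" if "lside X = Atom x \<or> rside X = Atom x"
    using X that followers.self[of X] lopts_Atom[of X] ropts_Atom[of X]
    by (force simp: dicot_scoring_def)
  show "scoring_nu (h + x) \<le> oL scoring_nu scoring_nu (G \<oplus> X)"
    if "lside H = Atom h" "lside X = Atom x" for h
    using ge that const oL_Atom[OF that(1), of scoring_nu scoring_nu]
      outcome_gsum_const_form[OF Om(1), of x]
    by (simp add: outcome_ge_def scoring_nu_def)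
  show "oR scoring_nu scoring_nu (H \<oplus> X) \<le> scoring_nu (g + x)"
    if "rside G = Atom g" "rside X = Atom x" for g
    using ge that const oR_Atom[OF that(1), of scoring_nu scoring_nu]
      outcome_gsum_const_form[OF Om(2), of x]
    by (simp add: outcome_ge_def scoring_nu_def)
qed

lemma game_ge_guaranteed_scoring:
  assumes U: "universe UNIV guaranteed_scoring"
    and G: "G \<in> guaranteed_scoring" and H: "H \<in> guaranteed_scoring"
    and m: "maintenance scoring_nu scoring_nu guaranteed_scoring G H"
    and geL: "protected_oL scoring_nu scoring_nu score_lower_wait H
      \<le> protected_oL scoring_nu scoring_nu score_lower_wait G"
    and geR: "protected_oR scoring_nu scoring_nu score_upper_wait H
      \<le> protected_oR scoring_nu scoring_nu score_upper_wait G"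
  shows "game_ge scoring_nu scoring_nu guaranteed_scoring G H"
proof (rule game_ge_if_maintenance[OF U G H m])
  have Om: "G \<in> Omega UNIV" "H \<in> Omega UNIV"
    using G H by (auto simp: guaranteed_scoring_def)
  fix X :: "real form" and x
  assume X: "X \<in> guaranteed_scoring"
  show "scoring_nu (h + x) \<le> oL scoring_nu scoring_nu (G \<oplus> X)"
    if side: "lside H = Atom h" and x: "lside X = Atom x" for h
  proof -
    \<comment> \<open>The adorn \<open>x\<close> enters additively through the waiting bound, while
      the protected outcomes give \<open>h \<le> oL (G \<oplus> score_lower_wait n)\<close>.\<close>
    obtain n where "oL scoring_nu scoring_nu (G \<oplus> score_lower_wait n) + x
        \<le> oL scoring_nu scoring_nu (G \<oplus> X)"
      using score_lower_wait_bound[OF G X x] by blast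
    then show ?thesis
      using protected_oL_ge_Atom[OF Om(1) waits_Omega(3) adorns_waits(3) _ side geL, of n]
      by (simp add: scoring_nu_def)
  qed
  show "oR scoring_nu scoring_nu (H \<oplus> X) \<le> scoring_nu (g + x)"
    if side: "rside G = Atom g" and x: "rside X = Atom x" for g
  proof -
    obtain n where "oR scoring_nu scoring_nu (H \<oplus> X)
        \<le> oR scoring_nu scoring_nu (H \<oplus> score_upper_wait n) + x"
      using score_upper_wait_bound[OF U H X x] by blast
    then show ?thesis
      using protected_oR_ge_Atom[OF Om(2) waits_Omega(4) adorns_waits(4) _ side geR, of n]
      by (simp add: scoring_nu_def)
  qed
qed

text \<open>The hypotheses make the sums to be compared atomic for the same player, so the claim
  reduces to adding \<open>x\<close> to an inequality of adorns.\<close>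

lemma game_ge_free_scoring:
  assumes "universe UNIV free_scoring" "G \<in> free_scoring" "H \<in> free_scoring"
    and "maintenance scoring_nu scoring_nu free_scoring G H"
    and L: "\<forall>a. lside H = Atom a \<longrightarrow> (\<exists>b. lside G = Atom b \<and> a \<le> b)"
    and R: "\<forall>a. rside G = Atom a \<longrightarrow> (\<exists>b. rside H = Atom b \<and> b \<le> a)"
  shows "game_ge scoring_nu scoring_nu free_scoring G H"
proof (rule game_ge_if_maintenance[OF assms(1-4)])
  fix X :: "real form" and x
  show "scoring_nu (h + x) \<le> oL scoring_nu scoring_nu (G \<oplus> X)"
    if "lside H = Atom h" "lside X = Atom x" for h
    using L that lside_gsum[OF _ that(2)] by (fastforce simp: oL_Atom scoring_nu_def)
  show "oR scoring_nu scoring_nu (H \<oplus> X) \<le> scoring_nu (g + x)"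
    if "rside G = Atom g" "rside X = Atom x" for g
    using R that rside_gsum[OF _ that(2)] by (fastforce simp: oR_Atom scoring_nu_def)
qed

theorem theorem40:
  "(\<forall>U G H.
      absolute_universe {0} {-1, 1} normal_nuL normal_nuR U \<and> G \<in> U \<and> H \<in> U \<and>
      maintenance normal_nuL normal_nuR U G H \<longrightarrow>
        (U = normal_play \<longrightarrow> game_ge normal_nuL normal_nuR U G H)) \<and>
   (\<forall>U G H.
      absolute_universe {0} {-1, 1} misere_nuL misere_nuR U \<and> G \<in> U \<and> H \<in> U \<and>
      maintenance misere_nuL misere_nuR U G H \<longrightarrow>
        (U = dicot_misere \<and> outcome_ge misere_nuL misere_nuR G H
          \<longrightarrow> game_ge misere_nuL misere_nuR U G H) \<and>
        (U = dead_ending_misere \<and>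
         protected_oL misere_nuL misere_nuR dead_lower_wait G
           \<ge> protected_oL misere_nuL misere_nuR dead_lower_wait H \<and>
         protected_oR misere_nuL misere_nuR dead_upper_wait G
           \<ge> protected_oR misere_nuL misere_nuR dead_upper_wait H
          \<longrightarrow> game_ge misere_nuL misere_nuR U G H) \<and>
        (U = free_misere \<and>
         (lside H = Atom 0 \<longrightarrow> lside G = Atom 0) \<and>
         (rside G = Atom 0 \<longrightarrow> rside H = Atom 0)
          \<longrightarrow> game_ge misere_nuL misere_nuR U G H)) \<and>
   (\<forall>U G H.
      absolute_universe UNIV UNIV scoring_nu scoring_nu U \<and> G \<in> U \<and> H \<in> U \<and>
      maintenance scoring_nu scoring_nu U G H \<longrightarrow>
        (U = dicot_scoring \<and> outcome_ge scoring_nu scoring_nu G H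
          \<longrightarrow> game_ge scoring_nu scoring_nu U G H) \<and>
        (U = guaranteed_scoring \<and>
         protected_oL scoring_nu scoring_nu score_lower_wait G
           \<ge> protected_oL scoring_nu scoring_nu score_lower_wait H \<and>
         protected_oR scoring_nu scoring_nu score_upper_wait G
           \<ge> protected_oR scoring_nu scoring_nu score_upper_wait H
          \<longrightarrow> game_ge scoring_nu scoring_nu U G H) \<and>
        (U = free_scoring \<and>
         (\<forall>a. lside H = Atom a \<longrightarrow> (\<exists>b. lside G = Atom b \<and> b \<ge> a)) \<and>
         (\<forall>a. rside G = Atom a \<longrightarrow> (\<exists>b. rside H = Atom b \<and> a \<ge> b))
          \<longrightarrow> game_ge scoring_nu scoring_nu U G H))"
  unfolding absolute_universe_def
  \<comment> \<open>Substituting the equation for \<open>U\<close> leaves, for each conjunct, one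
    matching lemma, whose premises are all among the assumptions.\<close>
  by (intro conjI allI impI; elim conjE; hypsubst)
    (rule game_ge_normal_play game_ge_dicot_misere game_ge_dead_ending_misere game_ge_free_misere
      game_ge_dicot_scoring game_ge_guaranteed_scoring game_ge_free_scoring; blast)+

end
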